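(* Given functional vset-automata $A_1,\dots,A_k$ with $\mathsf{Vars}(A_1)=\cdots=\mathsf{Vars}(A_k)$, one can construct in linear time a functional vset-automaton $A$ with $[\![A]\!]=[\![A_1\cup\cdots\cup A_k]\!]$.
   Context: Strings and spans. $\Sigma$ is a fixed finite alphabet with $|\Sigma|\ge 2$. A span of $\mathbf{s}=\sigma_1\cdots\sigma_\ell\in\Sigma^*$ is an expression $[i,j\rangle$ with $1\le i\le j\le \ell+1$. $\mathsf{Vars}$ is an infinite set of variables, disjoint from $\Sigma$. For finite $V\subset\mathsf{Vars}$, a $(V,\mathbf{s})$-tuple is a function from $V$ to the spans of $\mathbf{s}$; a spanner $P$ with finite variable set $\mathsf{Vars}(P)=V$ maps each $\mathbf{s}\in\Sigma^*$ to a set $P(\mathbf{s})$ of $(V,\mathbf{s})$-tuples. Ref-words. For finite $V\subset\mathsf{Vars}$ let $\Gamma_V=\{x{\vdash},\ {\dashv}x \mid x\in V\}$, disjoint from $\Sigma$. A word $\mathbf{r}\in(\Sigma\cup\Gamma_V)^*$ is valid for $V$ if for each $x\in V$ it contains exactly one $x{\vdash}$ and exactly one ${\dashv}x$, the former to the left of the latter. $\mathsf{clr}$ is the morphism erasing $\Gamma_V$ and fixing $\Sigma$. A valid $\mathbf{r}$ with $\mathsf{clr}(\mathbf{r})=\mathbf{s}$ defines the $(V,\mathbf{s})$-tuple $\mu^{\mathbf{r}}$: writing $\mathbf{r}=\mathbf{r}'_x\, x{\vdash}\,\mathbf{r}_x\,{\dashv}x\,\mathbf{r}''_x$, $\mu^{\mathbf{r}}(x)=[i,j\rangle$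 with $i=|\mathsf{clr}(\mathbf{r}'_x)|+1$, $j=i+|\mathsf{clr}(\mathbf{r}_x)|$. Vset-automata. A vset-automaton is a tuple $A=(V,Q,q_0,q_f,\delta)$ with $\mathsf{Vars}(A)=V\subset\mathsf{Vars}$ finite, $Q$ a finite set of states, $q_0,q_f\in Q$ initial and final states, and $\delta\colon Q\times(\Sigma\cup\{\epsilon\}\cup\Gamma_V)\to 2^Q$. $\mathcal{R}(A)$ is the set of words over $\Sigma\cup\Gamma_V$ accepted by $A$ viewed as an $\epsilon$-NFA. $[\![A]\!]$ is the spanner with variables $V$ and $[\![A]\!](\mathbf{s})=\{\mu^{\mathbf{r}}\mid\mathbf{r}\in\mathcal{R}(A)\text{ valid for }V,\ \mathsf{clr}(\mathbf{r})=\mathbf{s}\}$. $A$ is functional if every word in $\mathcal{R}(A)$ is valid for $V$. Union: $[\![A_1\cup\cdots\cup A_k]\!](\mathbf{s})=\bigcup_{i=1}^k[\![A_i]\!](\mathbf{s})$, with the common variable set. The number $k$ is not fixed. Running times are in the unit-cost RAM model with machine words of size logarithmic in the input size; linear means linear in the size (states and transitions) of the input automata. *)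

theory Defs
  imports Main "HOL-Library.Cardinality"
begin

section \<open>Spans, ref-words and spanners\<close>

datatype ('a, 'v) symbol = Letter 'a | Open 'v | Close 'v

text \<open>The pair \<open>(i, j)\<close> stands for the span \<open>[i, j\<rangle>\<close>.\<close>

type_synonym span = "nat \<times> nat"

definition spans :: "'a list \<Rightarrow> span set" where
  "spans s = {(i, j). 1 \<le> i \<and> i \<le> j \<and> j \<le> length s + 1}"

text \<open>The functions from \<open>V\<close> to the spans of \<open>s\<close>, as partial functions with domain \<open>V\<close>.\<close>

definition tuples :: "'v set \<Rightarrow> 'a list \<Rightarrow> ('v \<rightharpoonup> span) set" where
  "tuples V s = {\<mu>. dom \<mu> = V \<and> ran \<mu> \<subseteq> spans s}"

record ('a, 'v) spanner =
  sp_vars :: "'v set"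
  sp_eval :: "'a list \<Rightarrow> ('v \<rightharpoonup> span) set"

definition var_ops :: "'v set \<Rightarrow> ('a, 'v) symbol set" where
  "var_ops V = Open ` V \<union> Close ` V"

definition valid :: "'v set \<Rightarrow> ('a, 'v) symbol list \<Rightarrow> bool" where
  "valid V r \<longleftrightarrow> set r \<subseteq> range Letter \<union> var_ops V \<and>
     (\<forall>x\<in>V. count_list r (Open x) = 1 \<and> count_list r (Close x) = 1 \<and>
            (\<exists>r1 r2 r3. r = r1 @ Open x # r2 @ Close x # r3))"

fun clr :: "('a, 'v) symbol list \<Rightarrow> 'a list" where
  "clr [] = []"
| "clr (Letter a # r) = a # clr r"
| "clr (Open x # r) = clr r"
| "clr (Close x # r) = clr r"

definition var_span :: "('a, 'v) symbol list \<Rightarrow> 'v \<Rightarrow> span" where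
  "var_span r x = (THE (i, j). \<exists>r1 r2 r3. r = r1 @ Open x # r2 @ Close x # r3 \<and>
                      i = length (clr r1) + 1 \<and> j = i + length (clr r2))"

definition ref_tuple :: "'v set \<Rightarrow> ('a, 'v) symbol list \<Rightarrow> ('v \<rightharpoonup> span)" where
  "ref_tuple V r = (\<lambda>x. if x \<in> V then Some (var_span r x) else None)"

lemma clr_append [simp]: "clr (r @ r') = clr r @ clr r'"
  by (induction r rule: clr.induct) auto

lemma var_span_eq:
  assumes "count_list (r1 @ Open x # r2 @ Close x # r3) (Open x) = 1"
    and "count_list (r1 @ Open x # r2 @ Close x # r3) (Close x) = 1"
  shows "var_span (r1 @ Open x # r2 @ Close x # r3) x =
           (length (clr r1) + 1, length (clr r1) + 1 + length (clr r2))"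
proof -
  have n: "Open x \<notin> set r1" "Open x \<notin> set r2" "Open x \<notin> set r3"
          "Close x \<notin> set r1" "Close x \<notin> set r2" "Close x \<notin> set r3"
    using assms by (auto simp: count_list_0_iff)
  have u: "s1 = r1 \<and> s2 = r2"
    if "r1 @ Open x # r2 @ Close x # r3 = s1 @ Open x # s2 @ Close x # s3" for s1 s2 s3
  proof -
    have "r1 = s1 \<and> r2 @ Close x # r3 = s2 @ Close x # s3"
      using that n append_Cons_eq_iff[of "Open x" r1 "r2 @ Close x # r3" s1 "s2 @ Close x # s3"]
      by auto
    then show ?thesis
      using n append_Cons_eq_iff[of "Close x" r2 r3 s2 s3] by auto
  qed
  show ?thesis
    unfolding var_span_def
  proof (rule the_equality)
    show "case (length (clr r1) + 1, length (clr r1) + 1 + length (clr r2)) of (i, j) \<Rightarrow>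
      \<exists>s1 s2 s3. r1 @ Open x # r2 @ Close x # r3 = s1 @ Open x # s2 @ Close x # s3 \<and>
        i = length (clr s1) + 1 \<and> j = i + length (clr s2)"
      by blast
  qed (use u in fastforce)
qed

lemma ref_tuple_in_tuples:
  assumes "valid V r"
  shows "ref_tuple V r \<in> tuples V (clr r)"
proof -
  have "var_span r x \<in> spans (clr r)" if x: "x \<in> V" for x
  proof -
    obtain r1 r2 r3 where r: "r = r1 @ Open x # r2 @ Close x # r3"
      using assms x unfolding valid_def by blast
    have "var_span r x = (length (clr r1) + 1, length (clr r1) + 1 + length (clr r2))"
      using assms x unfolding r valid_def by (intro var_span_eq) auto
    then show ?thesis by (auto simp: spans_def r)
  qed
  then show ?thesis
    unfolding tuples_def ref_tuple_def dom_def ran_def by (auto split: if_splits; metis)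
qed


section \<open>Vset-automata\<close>

text \<open>In a transition, \<open>None\<close> is the label \<open>\<epsilon>\<close>.\<close>

record ('a, 'v, 'q) vset_automaton =
  vars :: "'v set"
  states :: "'q set"
  start :: 'q
  final :: 'q
  delta :: "'q \<Rightarrow> ('a, 'v) symbol option \<Rightarrow> 'q set"

text \<open>The transition function has domain \<open>Q \<times> (\<Sigma> \<union> {\<epsilon>} \<union> \<Gamma>\<^sub>V)\<close>; outside this domain the total
  HOL function \<open>delta A\<close> is required to be empty.\<close>

definition is_vset_automaton :: "('a, 'v, 'q) vset_automaton \<Rightarrow> bool" where
  "is_vset_automaton A \<longleftrightarrow>
     finite (vars A) \<and> finite (states A) \<and> start A \<in> states A \<and> final A \<in> states A \<and>
     (\<forall>p l. delta A p l \<subseteq> states A) \<and>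
     (\<forall>p l. delta A p l \<noteq> {} \<longrightarrow>
        p \<in> states A \<and> l \<in> insert None (Some ` (range Letter \<union> var_ops (vars A))))"

inductive path :: "('a, 'v, 'q) vset_automaton \<Rightarrow> 'q \<Rightarrow> ('a, 'v) symbol list \<Rightarrow> 'q \<Rightarrow> bool"
  for A where
  path_nil: "path A p [] p"
| path_eps: "p' \<in> delta A p None \<Longrightarrow> path A p' r q \<Longrightarrow> path A p r q"
| path_sym: "p' \<in> delta A p (Some \<sigma>) \<Longrightarrow> path A p' r q \<Longrightarrow> path A p (\<sigma> # r) q"

definition ref_lang :: "('a, 'v, 'q) vset_automaton \<Rightarrow> ('a, 'v) symbol list set" where
  "ref_lang A = {r. path A (start A) r (final A)}"

definition spanner_of :: "('a, 'v, 'q) vset_automaton \<Rightarrow> ('a, 'v) spanner" where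
  "spanner_of A =
     \<lparr>sp_vars = vars A,
      sp_eval = (\<lambda>s. {ref_tuple (vars A) r | r. r \<in> ref_lang A \<and> valid (vars A) r \<and> clr r = s})\<rparr>"

definition functional :: "('a, 'v, 'q) vset_automaton \<Rightarrow> bool" where
  "functional A \<longleftrightarrow> (\<forall>r\<in>ref_lang A. valid (vars A) r)"

definition union_spanner :: "'v set \<Rightarrow> ('a, 'v, 'q) vset_automaton list \<Rightarrow> ('a, 'v) spanner" where
  "union_spanner V As =
     \<lparr>sp_vars = V, sp_eval = (\<lambda>s. \<Union>A\<in>set As. sp_eval (spanner_of A) s)\<rparr>"

definition transitions ::
  "('a, 'v, 'q) vset_automaton \<Rightarrow> ('q \<times> ('a, 'v) symbol option \<times> 'q) set" where
  "transitions A = {(p, l, q). q \<in> delta A p l}"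

definition aut_size :: "('a, 'v, 'q) vset_automaton \<Rightarrow> nat" where
  "aut_size A = card (states A) + card (transitions A)"


section \<open>A unit-cost RAM with \<open>w\<close>-bit words\<close>

text \<open>Register and jump arguments are constants of the program, so a program uses finitely many
  registers; the memory is accessed only indirectly, through \<open>Load\<close> and \<open>Store\<close>. Arithmetic is
  modulo \<open>2 ^ w\<close>. There are no further operations (multiplication, bit operations): this
  only makes upper bounds on running times stronger.\<close>

datatype instr =
    Const nat nat
  | Move nat nat
  | Add nat nat nat
  | Sub nat nat nat
  | Load nat nat
  | Store nat nat
  | Jump nat
  | JumpLess nat nat nat

record ram =
  pc :: nat
  reg :: "nat \<Rightarrow> nat"
  mem :: "nat \<Rightarrow> nat"

fun exec :: "nat \<Rightarrow> instr \<Rightarrow> ram \<Rightarrow> ram" where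
  "exec w (Const i c) C = C\<lparr>pc := pc C + 1, reg := (reg C)(i := c mod 2 ^ w)\<rparr>"
| "exec w (Move i j) C = C\<lparr>pc := pc C + 1, reg := (reg C)(i := reg C j)\<rparr>"
| "exec w (Add i j k) C = C\<lparr>pc := pc C + 1, reg := (reg C)(i := (reg C j + reg C k) mod 2 ^ w)\<rparr>"
| "exec w (Sub i j k) C =
     C\<lparr>pc := pc C + 1, reg := (reg C)(i := (reg C j + 2 ^ w - reg C k) mod 2 ^ w)\<rparr>"
| "exec w (Load i j) C = C\<lparr>pc := pc C + 1, reg := (reg C)(i := mem C (reg C j))\<rparr>"
| "exec w (Store i j) C = C\<lparr>pc := pc C + 1, mem := (mem C)(reg C i := reg C j)\<rparr>"
| "exec w (Jump l) C = C\<lparr>pc := l\<rparr>"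
| "exec w (JumpLess i j l) C = C\<lparr>pc := (if reg C i < reg C j then l else pc C + 1)\<rparr>"

definition halted :: "instr list \<Rightarrow> ram \<Rightarrow> bool" where
  "halted P C \<longleftrightarrow> length P \<le> pc C"

definition step :: "nat \<Rightarrow> instr list \<Rightarrow> ram \<Rightarrow> ram" where
  "step w P C = (if halted P C then C else exec w (P ! pc C) C)"

text \<open>The input occupies the memory from address \<open>0\<close> on; everything else is \<open>0\<close>.\<close>

definition initial_ram :: "nat list \<Rightarrow> ram" where
  "initial_ram inp =
     \<lparr>pc = 0, reg = (\<lambda>_. 0), mem = (\<lambda>a. if a < length inp then inp ! a else 0)\<rparr>"

text \<open>On input \<open>inp\<close>, the program \<open>P\<close> halts after at most \<open>T\<close> steps with the words \<open>out\<close> in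
  consecutive memory cells, register \<open>0\<close> holding the address of the first of them.\<close>

definition outputs_within ::
  "nat \<Rightarrow> instr list \<Rightarrow> nat list \<Rightarrow> nat \<Rightarrow> nat list \<Rightarrow> bool" where
  "outputs_within w P inp T out \<longleftrightarrow>
     (\<exists>t\<le>T. \<exists>C. C = (step w P ^^ t) (initial_ram inp) \<and> halted P C \<and>
        reg C 0 + length out \<le> 2 ^ w \<and> (\<forall>i<length out. mem C (reg C 0 + i) = out ! i))"


section \<open>Automata as sequences of machine words\<close>

text \<open>Letters and variables are represented by their numbers under \<open>\<alpha>\<close> and \<open>\<nu>\<close>, states by their
  numbers under \<open>\<eta>\<close>. A transition takes four words.\<close>

fun label_words ::
  "('a \<Rightarrow> nat) \<Rightarrow> ('v \<Rightarrow> nat) \<Rightarrow> ('a, 'v) symbol option \<Rightarrow> nat list" where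
  "label_words \<alpha> \<nu> None = [0, 0]"
| "label_words \<alpha> \<nu> (Some (Letter a)) = [1, \<alpha> a]"
| "label_words \<alpha> \<nu> (Some (Open x)) = [2, \<nu> x]"
| "label_words \<alpha> \<nu> (Some (Close x)) = [3, \<nu> x]"

fun transition_words ::
  "('a \<Rightarrow> nat) \<Rightarrow> ('v \<Rightarrow> nat) \<Rightarrow> ('q \<Rightarrow> nat) \<Rightarrow> 'q \<times> ('a, 'v) symbol option \<times> 'q \<Rightarrow> nat list"
  where "transition_words \<alpha> \<nu> \<eta> (p, l, q) = \<eta> p # label_words \<alpha> \<nu> l @ [\<eta> q]"

text \<open>Any numbering of the states by \<open>0, \<dots>, |Q| - 1\<close> and any ordering of the transitions is
  admitted. The variable set is given by its cardinality, because \<open>\<nu>\<close> is going to number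
  it by \<open>0, \<dots>, |V| - 1\<close>; thus it takes a single word.\<close>

definition encodes ::
  "('a \<Rightarrow> nat) \<Rightarrow> ('v \<Rightarrow> nat) \<Rightarrow> ('a, 'v, 'q) vset_automaton \<Rightarrow> nat list \<Rightarrow> bool" where
  "encodes \<alpha> \<nu> A ws \<longleftrightarrow>
     (\<exists>\<eta> ts. bij_betw \<eta> (states A) {..<card (states A)} \<and>
        distinct ts \<and> set ts = transitions A \<and>
        ws = [card (vars A), card (states A), \<eta> (start A), \<eta> (final A), length ts]
             @ concat (map (transition_words \<alpha> \<nu> \<eta>) ts))"

definition encodes_list ::
  "('a \<Rightarrow> nat) \<Rightarrow> ('v \<Rightarrow> nat) \<Rightarrow> ('a, 'v, 'q) vset_automaton list \<Rightarrow> nat list \<Rightarrow> bool" where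
  "encodes_list \<alpha> \<nu> As ws \<longleftrightarrow>
     (\<exists>wss. list_all2 (encodes \<alpha> \<nu>) As wss \<and> ws = length As # concat wss)"

end

theory Submission
  imports Defs
begin

text \<open>The union automaton is the disjoint union of the given automata, with the states of each shifted
  past those of its predecessors, plus a new initial state with \<open>\<epsilon>\<close>-transitions to all
  initial states and a new final state with \<open>\<epsilon>\<close>-transitions from all final states; a path
  between the new states stays in one automaton, so the accepted ref-words are the union of the given ones.
  For linear time, a single pass over the input suffices: the number of states and transitions, which
  the output states first, are known only at the end, so the output is written backwards, starting at the
  top of the address space, where it cannot collide with the input.\<close>

section \<open>The union automaton\<close>

type_synonym ('a, 'v, 'q) transition = "'q \<times> ('a, 'v) symbol option \<times> 'q"

fun map_transition ::
  "('q \<Rightarrow> 'p) \<Rightarrow> ('a, 'v, 'q) transition \<Rightarrow> ('a, 'v, 'p) transition" where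
  "map_transition e (p, l, q) = (e p, l, e q)"

text \<open>\<open>encodes\<close> asserts only that some state numbering and some transition order
  exist. Both are fixed here, so that the output becomes a function of the list of
  components.\<close>

type_synonym ('a, 'v, 'q) component =
  "('a, 'v, 'q) vset_automaton \<times> ('q \<Rightarrow> nat) \<times> ('a, 'v, 'q) transition list"

fun component :: "('a, 'v, 'q) component \<Rightarrow> bool" where
  "component (A, \<eta>, ts) \<longleftrightarrow>
     is_vset_automaton A \<and> bij_betw \<eta> (states A) {..<card (states A)} \<and>
     distinct ts \<and> set ts = transitions A"

fun num_states :: "('a, 'v, 'q) component \<Rightarrow> nat" where
  "num_states (A, \<eta>, ts) = card (states A)"

fun num_transitions :: "('a, 'v, 'q) component \<Rightarrow> nat" where
  "num_transitions (A, \<eta>, ts) = length ts"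

text \<open>The state \<open>0\<close> is the new initial and \<open>1\<close> the new final state. The transitions come in the
  order in which a program produces them that writes its output from the last word to the first.\<close>

fun component_transitions ::
  "nat \<Rightarrow> ('a, 'v, 'q) component \<Rightarrow> ('a, 'v, nat) transition list" where
  "component_transitions k (A, \<eta>, ts) =
     map (map_transition (\<lambda>q. \<eta> q + k)) (rev ts) @
     [(\<eta> (final A) + k, None, 1), (0, None, \<eta> (start A) + k)]"

fun union_transitions ::
  "nat \<Rightarrow> ('a, 'v, 'q) component list \<Rightarrow> ('a, 'v, nat) transition list" where
  "union_transitions k [] = []"
| "union_transitions k (X # Xs) =
     union_transitions (k + num_states X) Xs @ component_transitions k X"

text \<open>Makes the offsets explicit, so that \<open>set_union_transitions\<close> can replace the
  recursion by an indexed union.\<close>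

fun placed :: "nat \<Rightarrow> ('a, 'v, 'q) component list \<Rightarrow> (nat \<times> ('a, 'v, 'q) component) list" where
  "placed k [] = []"
| "placed k (X # Xs) = (k, X) # placed (k + num_states X) Xs"

text \<open>The states form an initial segment of the naturals, so the identity is an admissible
  numbering for \<open>encodes\<close>.\<close>

definition union_automaton ::
  "'v set \<Rightarrow> ('a, 'v, 'q) component list \<Rightarrow> ('a, 'v, nat) vset_automaton" where
  "union_automaton V Xs =
     \<lparr>vars = V, states = {..<2 + (\<Sum>X\<leftarrow>Xs. num_states X)}, start = 0, final = 1,
      delta = (\<lambda>p l. {q. (p, l, q) \<in> set (union_transitions 2 Xs)})\<rparr>"

section \<open>Disjoint blocks of shifted states and distinctness of the transitions\<close>

lemma snd_set_placed: "snd ` set (placed k Xs) = set Xs"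
  by (induction Xs arbitrary: k) auto

lemma placed_bounds:
  "(m, X) \<in> set (placed k Xs) \<Longrightarrow> k \<le> m \<and> m + num_states X \<le> k + (\<Sum>X\<leftarrow>Xs. num_states X)"
  by (induction Xs arbitrary: k) fastforce+

text \<open>The blocks follow one another by \<open>placed_bounds\<close>, so a number in two of
  them identifies the entry. The offset is included because a component may occur repeatedly in the
  list.\<close>

lemma placed_disjoint:
  assumes "(m, X) \<in> set (placed k Xs)" "(m', X') \<in> set (placed k Xs)"
    and "m \<le> u" "u < m + num_states X" "m' \<le> u" "u < m' + num_states X'"
  shows "m = m' \<and> X = X'"
  using assms
proof (induction Xs arbitrary: k)
  case (Cons Y Ys)
  then show ?case
    using placed_bounds[of m X "k + num_states Y" Ys] placed_bounds[of m' X' "k + num_states Y" Ys]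
    by auto
qed simp

lemma set_union_transitions:
  "set (union_transitions k Xs) = (\<Union>(m, X)\<in>set (placed k Xs). set (component_transitions m X))"
  by (induction Xs arbitrary: k) auto

lemma component_bound:
  assumes "component (A, \<eta>, ts)" "q \<in> states A"
  shows "\<eta> q < card (states A)"
  using assms by (auto simp: bij_betw_def)

lemma component_transitionD:
  assumes "component (A, \<eta>, ts)" "(p, l, q) \<in> set ts"
  shows "p \<in> states A" "q \<in> states A" "l \<in> insert None (Some ` (range Letter \<union> var_ops (vars A)))"
  using assms unfolding component.simps is_vset_automaton_def transitions_def by blast+

text \<open>\<open>\<eta>\<close> is injective only on \<open>states A\<close>, but that set
  contains the endpoints of all transitions.\<close>

lemma map_transition_inj_on:
  assumes "component (A, \<eta>, ts)"
  shows "inj_on (map_transition (\<lambda>q. \<eta> q + k)) (set ts)"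
proof (rule inj_onI)
  fix t t' assume t: "t \<in> set ts" "t' \<in> set ts"
    "map_transition (\<lambda>q. \<eta> q + k) t = map_transition (\<lambda>q. \<eta> q + k) t'"
  have "inj_on \<eta> (states A)" using assms by (simp add: bij_betw_def)
  then show "t = t'"
    using t component_transitionD[OF assms] by (cases t; cases t') (auto dest: inj_onD)
qed

text \<open>Each new transition can be attributed to its component by a state other than the new ones.\<close>

fun witness_state :: "('a, 'v, nat) transition \<Rightarrow> nat" where
  "witness_state (p, l, q) = (if p = 0 then q else p)"

lemma witness_state_bounds:
  assumes "component X" "t \<in> set (component_transitions k X)" "0 < k"
  shows "k \<le> witness_state t \<and> witness_state t < k + num_states X"
proof -
  obtain A \<eta> ts where X: "X = (A, \<eta>, ts)" by (cases X)
  have "start A \<in> states A" "final A \<in> states A"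
    using assms(1) by (auto simp: X is_vset_automaton_def)
  then show ?thesis
    using assms component_bound[of A \<eta> ts] component_transitionD[of A \<eta> ts] by (auto simp: X)
qed

text \<open>With \<open>2 \<le> k\<close> no shifted state is \<open>0\<close> or \<open>1\<close>,
  so the two new transitions differ from the copied ones.\<close>

lemma distinct_component_transitions:
  assumes "component X" "2 \<le> k"
  shows "distinct (component_transitions k X)"
proof -
  obtain A \<eta> ts where X: "X = (A, \<eta>, ts)" by (cases X)
  show ?thesis
    using assms map_transition_inj_on[of A \<eta> ts k] by (auto simp: X distinct_map)
qed

text \<open>The witness states of the tail lie at or above \<open>k + num_states X\<close>, those of
  the head below it. Distinctness is demanded by \<open>encodes\<close>.\<close>

lemma distinct_union_transitions:
  assumes "\<forall>X\<in>set Xs. component X" "2 \<le> k"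
  shows "distinct (union_transitions k Xs)"
  using assms
proof (induction Xs arbitrary: k)
  case (Cons X Xs)
  have "t \<notin> set (component_transitions k X)"
    if t: "t \<in> set (union_transitions (k + num_states X) Xs)" for t
  proof -
    obtain m Y where Y: "(m, Y) \<in> set (placed (k + num_states X) Xs)"
      "t \<in> set (component_transitions m Y)"
      using t by (auto simp: set_union_transitions)
    have "Y \<in> set Xs" using Y(1) snd_set_placed[of "k + num_states X" Xs] by force
    then have "k + num_states X \<le> witness_state t"
      using placed_bounds[OF Y(1)] witness_state_bounds[of Y t m] Y(2) Cons.prems by force
    then show ?thesis
      using witness_state_bounds[of X t k] Cons.prems by force
  qed
  then show ?case
    using Cons distinct_component_transitions[of X k] by auto
qed simp

section \<open>Ref-words and spanner of the union automaton\<close>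

locale components =
  fixes V :: "'v set" and Xs :: "('a, 'v, 'q) component list"
  assumes nonempty: "Xs \<noteq> []"
    and component: "X \<in> set Xs \<Longrightarrow> component X"
    and vars_component: "X \<in> set Xs \<Longrightarrow> vars (fst X) = V"
begin

abbreviation "U \<equiv> union_automaton V Xs"

lemma placed_component:
  assumes "(k, A, \<eta>, ts) \<in> set (placed 2 Xs)"
  shows "component (A, \<eta>, ts)" "vars A = V" "2 \<le> k"
    "k + card (states A) \<le> 2 + (\<Sum>X\<leftarrow>Xs. num_states X)"
proof -
  have "(A, \<eta>, ts) \<in> snd ` set (placed 2 Xs)"
    using imageI[OF assms, of snd] by simp
  then have X: "(A, \<eta>, ts) \<in> set Xs" by (simp only: snd_set_placed)
  show "component (A, \<eta>, ts)" by (rule component[OF X])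
  show "vars A = V" using vars_component[OF X] by simp
  show "2 \<le> k" "k + card (states A) \<le> 2 + (\<Sum>X\<leftarrow>Xs. num_states X)"
    using placed_bounds[OF assms] by auto
qed

text \<open>The three cases are copies, exits to \<open>1\<close> and entries from \<open>0\<close>.
  The conjunct \<open>p' \<in> states A\<close> is recorded because \<open>\<eta>\<close> can be
  inverted only on states.\<close>

lemma delta_U_iff:
  "q \<in> delta U p l \<longleftrightarrow>
     (\<exists>k A \<eta> ts. (k, A, \<eta>, ts) \<in> set (placed 2 Xs) \<and>
        ((\<exists>p' q'. p = \<eta> p' + k \<and> q = \<eta> q' + k \<and> p' \<in> states A \<and> q' \<in> delta A p' l) \<or>
         p = \<eta> (final A) + k \<and> l = None \<and> q = 1 \<or>
         p = 0 \<and> l = None \<and> q = \<eta> (start A) + k))" (is "_ \<longleftrightarrow> ?R")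
proof
  assume "q \<in> delta U p l"
  then obtain k A \<eta> ts where X: "(k, A, \<eta>, ts) \<in> set (placed 2 Xs)"
    and t: "(p, l, q) \<in> set (component_transitions k (A, \<eta>, ts))"
    unfolding union_automaton_def by (auto simp: set_union_transitions)
  note c = placed_component(1)[OF X]
  have "set ts = transitions A" using c by simp
  then have "q' \<in> delta A p' l' \<and> p' \<in> states A" if "(p', l', q') \<in> set ts" for p' l' q'
    using that component_transitionD[OF c that] by (auto simp: transitions_def)
  then show ?R using X t by fastforce
next
  assume ?R
  then obtain k A \<eta> ts where X: "(k, A, \<eta>, ts) \<in> set (placed 2 Xs)"
    and t: "(\<exists>p' q'. p = \<eta> p' + k \<and> q = \<eta> q' + k \<and> q' \<in> delta A p' l) \<or>
         p = \<eta> (final A) + k \<and> l = None \<and> q = 1 \<or>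
         p = 0 \<and> l = None \<and> q = \<eta> (start A) + k"
    by blast
  have "set ts = transitions A" using placed_component(1)[OF X] by simp
  then have "map_transition (\<lambda>q. \<eta> q + k) (p', l, q') \<in> map_transition (\<lambda>q. \<eta> q + k) ` set ts"
    if "q' \<in> delta A p' l" for p' q'
    using that by (intro imageI) (simp add: transitions_def)
  then have "(p, l, q) \<in> set (component_transitions k (A, \<eta>, ts))"
    using t by auto
  then have "(p, l, q) \<in> set (union_transitions 2 Xs)"
    unfolding set_union_transitions by (intro UN_I[OF X]) simp
  then show "q \<in> delta U p l"
    by (simp add: union_automaton_def)
qed

lemma vars_U: "vars U = V"
  by (simp add: union_automaton_def)

lemma is_vset_automaton_U: "is_vset_automaton U"
proof -
  \<comment> \<open>Finiteness of \<open>V\<close> is inherited from any member of the nonempty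
    list.\<close>
  obtain A \<eta> ts where "(A, \<eta>, ts) \<in> set Xs"
    using nonempty by (metis list.set_intros(1) neq_Nil_conv prod_cases3)
  then have "finite V"
    using component[of "(A, \<eta>, ts)"] vars_component[of "(A, \<eta>, ts)"]
    by (simp add: is_vset_automaton_def)
  moreover have "p \<in> states U \<and> q \<in> states U \<and>
      l \<in> insert None (Some ` (range Letter \<union> var_ops V))" if q: "q \<in> delta U p l" for p q l
  proof -
    have st: "states U = {..<2 + (\<Sum>X\<leftarrow>Xs. num_states X)}" by (simp add: union_automaton_def)
    obtain k A \<eta> ts where X: "(k, A, \<eta>, ts) \<in> set (placed 2 Xs)" and
      t: "(\<exists>p' q'. p = \<eta> p' + k \<and> q = \<eta> q' + k \<and> p' \<in> states A \<and> q' \<in> delta A p' l) \<or>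
         p = \<eta> (final A) + k \<and> l = None \<and> q = 1 \<or>
         p = 0 \<and> l = None \<and> q = \<eta> (start A) + k"
      using q unfolding delta_U_iff by blast
    note c = placed_component[OF X]
    have A: "is_vset_automaton A" using c by simp
    have b: "\<eta> x + k < 2 + (\<Sum>X\<leftarrow>Xs. num_states X)" if "x \<in> states A" for x
      using component_bound[OF c(1) that] c(4) by linarith
    have "q' \<in> states A \<and> l \<in> insert None (Some ` (range Letter \<union> var_ops V))"
      if "q' \<in> delta A p' l" for p' q'
      using that A c(2) unfolding is_vset_automaton_def by blast
    moreover have "start A \<in> states A" "final A \<in> states A"
      using A unfolding is_vset_automaton_def by auto
    ultimately show ?thesis using t b unfolding st by auto
  qed
  ultimately show ?thesis
    unfolding is_vset_automaton_def vars_U by (auto simp: union_automaton_def)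
qed

lemma path_embed:
  assumes "(k, A, \<eta>, ts) \<in> set (placed 2 Xs)" "path A p r q" "p \<in> states A"
  shows "path U (\<eta> p + k) r (\<eta> q + k)"
  using assms(2,3)
proof induction
  case (path_nil p)
  show ?case by (rule path.path_nil)
next
  case (path_eps p' p r q)
  have "is_vset_automaton A" using placed_component(1)[OF assms(1)] by simp
  then have "p' \<in> states A" using path_eps.hyps(1) unfolding is_vset_automaton_def by blast
  moreover have "\<eta> p' + k \<in> delta U (\<eta> p + k) None"
    using path_eps.hyps(1) path_eps.prems assms(1) unfolding delta_U_iff by blast
  ultimately show ?case using path_eps.IH by (blast intro: path.path_eps)
next
  case (path_sym p' p \<sigma> r q)
  have "is_vset_automaton A" using placed_component(1)[OF assms(1)] by simp
  then have "p' \<in> states A" using path_sym.hyps(1) unfolding is_vset_automaton_def by blast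
  moreover have "\<eta> p' + k \<in> delta U (\<eta> p + k) (Some \<sigma>)"
    using path_sym.hyps(1) path_sym.prems assms(1) unfolding delta_U_iff by blast
  ultimately show ?case using path_sym.IH by (blast intro: path.path_sym)
qed

text \<open>A block can be left only from its final state: the number \<open>\<eta> p + k\<close>
  determines the block by \<open>placed_disjoint\<close>, and then \<open>p\<close> by injectivity
  of \<open>\<eta>\<close>.\<close>

lemma delta_U_embedD:
  assumes X: "(k, A, \<eta>, ts) \<in> set (placed 2 Xs)" and p: "p \<in> states A"
    and q: "q \<in> delta U (\<eta> p + k) l"
  shows "(\<exists>q'. q = \<eta> q' + k \<and> q' \<in> states A \<and> q' \<in> delta A p l) \<or> p = final A \<and> l = None \<and> q = 1"
proof -
  note c = placed_component[OF X]
  obtain k' A' \<eta>' ts' where X': "(k', A', \<eta>', ts') \<in> set (placed 2 Xs)" and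
    t: "(\<exists>p' q'. \<eta> p + k = \<eta>' p' + k' \<and> q = \<eta>' q' + k' \<and> p' \<in> states A' \<and> q' \<in> delta A' p' l) \<or>
       \<eta> p + k = \<eta>' (final A') + k' \<and> l = None \<and> q = 1 \<or>
       \<eta> p + k = 0 \<and> l = None \<and> q = \<eta>' (start A') + k'"
    using q unfolding delta_U_iff by blast
  note c' = placed_component[OF X']
  have A: "is_vset_automaton A" "is_vset_automaton A'" "inj_on \<eta> (states A)"
    using c c' by (auto simp: bij_betw_def)
  have f': "final A' \<in> states A'" using A unfolding is_vset_automaton_def by auto
  \<comment> \<open>Entries start at \<open>0\<close>, which is below every block; in the other two
    cases the source is a shifted state of \<open>A'\<close>.\<close>
  obtain p' where p': "\<eta> p + k = \<eta>' p' + k'" "p' \<in> states A'"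
    using t f' c(3) by auto
  have eq: "k' = k" "A' = A" "\<eta>' = \<eta>" "ts' = ts"
    using placed_disjoint[OF X X', of "\<eta> p + k"] component_bound[OF c(1) p]
      component_bound[OF c'(1) p'(2)] p'(1) by auto
  have "p'' = p" if "\<eta> p + k = \<eta> p'' + k" "p'' \<in> states A" for p''
    using that A(3) p by (auto dest: inj_onD)
  moreover have "q' \<in> states A" if "q' \<in> delta A p' l" for p' q'
    using that A(1) unfolding is_vset_automaton_def by blast
  moreover have "\<eta> p + k \<noteq> 0" using c(3) by simp
  ultimately show ?thesis
    using t f' unfolding eq by metis
qed

lemma delta_U_final: "delta U (Suc 0) l = {}"
proof -
  have "q \<notin> delta U (Suc 0) l" for q
    unfolding delta_U_iff by (auto dest: placed_component(3))
  then show ?thesis by blast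
qed

lemma path_U_final:
  assumes "path U (Suc 0) r q"
  shows "r = []"
  using assms by cases (auto simp: delta_U_final)

text \<open>The path follows copied transitions until it takes the exit from \<open>final A\<close>.
  By \<open>path_U_final\<close> no symbol remains to be read then.\<close>

lemma path_embedD:
  assumes X: "(k, A, \<eta>, ts) \<in> set (placed 2 Xs)"
    and "path U u r v" "u = \<eta> p + k" "p \<in> states A" "v = 1"
  shows "path A p r (final A)"
  using assms(2-)
proof (induction arbitrary: p)
  case (path_nil u)
  \<comment> \<open>An empty path would give \<open>\<eta> p + k = 1\<close>, against
    \<open>2 \<le> k\<close>.\<close>
  then show ?case using placed_component(3)[OF X] by simp
next
  case (path_eps u' u r v)
  from delta_U_embedD[OF X path_eps.prems(2)] path_eps.hyps(1)[unfolded path_eps.prems(1)]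
  consider q where "u' = \<eta> q + k" "q \<in> states A" "q \<in> delta A p None" | "p = final A" "u' = 1"
    by blast
  then show ?case
  proof cases
    case 1
    then show ?thesis using path_eps by (blast intro: path.path_eps)
  next
    case 2
    then show ?thesis using path_eps.hyps(2) path_U_final by (auto intro: path.path_nil)
  qed
next
  case (path_sym u' u \<sigma> r v)
  from delta_U_embedD[OF X path_sym.prems(2)] path_sym.hyps(1)[unfolded path_sym.prems(1)]
  obtain q where "u' = \<eta> q + k" "q \<in> states A" "q \<in> delta A p (Some \<sigma>)"
    by blast
  then show ?case using path_sym by (blast intro: path.path_sym)
qed

lemma delta_U_start:
  "q \<in> delta U 0 l \<longleftrightarrow>
     l = None \<and> (\<exists>k A \<eta> ts. (k, A, \<eta>, ts) \<in> set (placed 2 Xs) \<and> q = \<eta> (start A) + k)"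
  unfolding delta_U_iff by (auto dest: placed_component(3))

lemma ref_lang_U: "ref_lang U = (\<Union>X\<in>set Xs. ref_lang (fst X))"
proof (intro equalityI subsetI)
  fix r assume "r \<in> ref_lang U"
  then have "path U 0 r 1" by (simp add: ref_lang_def union_automaton_def)
  then obtain k A \<eta> ts where X: "(k, A, \<eta>, ts) \<in> set (placed 2 Xs)"
    and p: "path U (\<eta> (start A) + k) r 1"
    by cases (auto simp: delta_U_start)
  have "start A \<in> states A"
    using placed_component(1)[OF X] by (simp add: is_vset_automaton_def)
  then have "r \<in> ref_lang A"
    using path_embedD[OF X p] by (simp add: ref_lang_def)
  then show "r \<in> (\<Union>X\<in>set Xs. ref_lang (fst X))"
    using X snd_set_placed[of 2 Xs] by force
next
  fix r assume "r \<in> (\<Union>X\<in>set Xs. ref_lang (fst X))"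
  then obtain k A \<eta> ts where X: "(k, A, \<eta>, ts) \<in> set (placed 2 Xs)" and r: "r \<in> ref_lang A"
    using snd_set_placed[of 2 Xs] by force
  have st: "start A \<in> states A" "final A \<in> states A"
    using placed_component(1)[OF X] by (auto simp: is_vset_automaton_def)
  have "path U (\<eta> (start A) + k) r (\<eta> (final A) + k)"
    using path_embed[OF X _ st(1)] r by (simp add: ref_lang_def)
  \<comment> \<open>\<open>path\<close> prepends transitions, so appending the exit transition takes
    an induction.\<close>
  moreover have "path U u r 1" if "path U u r v" "v = \<eta> (final A) + k" for u v
    using that
  proof induction
    case (path_nil u)
    then have "1 \<in> delta U u None" using X unfolding delta_U_iff by blast
    then show ?case by (blast intro: path.intros)
  qed (blast intro: path.intros)+
  ultimately have "path U (\<eta> (start A) + k) r 1" by blast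
  moreover have "\<eta> (start A) + k \<in> delta U 0 None" using X unfolding delta_U_start by blast
  ultimately have "path U 0 r 1" by (rule path.path_eps[rotated])
  then show "r \<in> ref_lang U" by (simp add: ref_lang_def union_automaton_def)
qed

lemma spanner_of_U: "spanner_of U = union_spanner V (map fst Xs)"
  unfolding spanner_of_def union_spanner_def ref_lang_U vars_U
  by (rule arg_cong[where f = "\<lambda>e. \<lparr>sp_vars = V, sp_eval = e\<rparr>"])
    (force simp: fun_eq_iff vars_component)

lemma functional_U:
  assumes "\<And>X. X \<in> set Xs \<Longrightarrow> functional (fst X)"
  shows "functional U"
  using assms vars_component by (fastforce simp: functional_def ref_lang_U vars_U)

lemma encodes_U:
  "encodes \<alpha> \<nu> U
     ([card V, 2 + (\<Sum>X\<leftarrow>Xs. num_states X), 0, 1, length (union_transitions 2 Xs)] @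
      concat (map (transition_words \<alpha> \<nu> (\<lambda>q. q)) (union_transitions 2 Xs)))"
proof -
  have "distinct (union_transitions 2 Xs)"
    using component by (intro distinct_union_transitions) auto
  moreover have "set (union_transitions 2 Xs) = transitions U"
    by (auto simp: transitions_def union_automaton_def)
  ultimately show ?thesis
    unfolding encodes_def
    by (intro exI[of _ "\<lambda>q. q"] exI[of _ "union_transitions 2 Xs"]) (simp add: union_automaton_def bij_betw_def)
qed

end


section \<open>Streaming programs\<close>

text \<open>A streaming program reads its input once from left to right and writes its output from the last
  word to the first, downwards from the address \<open>2 ^ w\<close>. Register \<open>0\<close> holds the address of
  the last word written (initially \<open>2 ^ w\<close>, that is, \<open>0\<close>), register \<open>1\<close> the
  address of the next word to be read, registers \<open>7\<close> and \<open>8\<close> the constants \<open>0\<close> and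
  \<open>1\<close>.\<close>

datatype macro = Read nat | Emit nat | Plus nat nat nat | Minus nat nat nat

fun code :: "macro \<Rightarrow> instr list" where
  "code (Read i) = [Load i 1, Add 1 1 8]"
| "code (Emit i) = [Sub 0 0 8, Store 0 i]"
| "code (Plus i j k) = [Add i j k]"
| "code (Minus i j k) = [Sub i j k]"

type_synonym stream_state = "nat list \<times> nat list \<times> (nat \<Rightarrow> nat)"

text \<open>Arithmetic on unbounded naturals; \<open>safe_macro\<close> gives the conditions under
  which it agrees with arithmetic modulo \<open>2 ^ w\<close>.\<close>

fun run_macro :: "macro \<Rightarrow> stream_state \<Rightarrow> stream_state" where
  "run_macro (Read i) (rest, out, g) = (tl rest, out, g(i := hd rest))"
| "run_macro (Emit i) (rest, out, g) = (rest, g i # out, g)"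
| "run_macro (Plus i j k) (rest, out, g) = (rest, out, g(i := g j + g k))"
| "run_macro (Minus i j k) (rest, out, g) = (rest, out, g(i := g j - g k))"

definition free_reg :: "nat \<Rightarrow> bool" where
  "free_reg i \<longleftrightarrow> 2 \<le> i \<and> i \<noteq> 7 \<and> i \<noteq> 8"

text \<open>The bound for \<open>Emit\<close> keeps the output from overwriting the input. Registers
  \<open>0\<close> and \<open>1\<close> are excluded as operands because \<open>g\<close> does not
  describe them.\<close>

fun safe_macro :: "nat \<Rightarrow> nat list \<Rightarrow> macro \<Rightarrow> stream_state \<Rightarrow> bool" where
  "safe_macro w inp (Read i) (rest, out, g) \<longleftrightarrow> free_reg i \<and> rest \<noteq> []"
| "safe_macro w inp (Emit i) (rest, out, g) \<longleftrightarrow> 2 \<le> i \<and> length inp + length out < 2 ^ w"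
| "safe_macro w inp (Plus i j k) (rest, out, g) \<longleftrightarrow>
     free_reg i \<and> 2 \<le> j \<and> 2 \<le> k \<and> g j + g k < 2 ^ w"
| "safe_macro w inp (Minus i j k) (rest, out, g) \<longleftrightarrow>
     free_reg i \<and> 2 \<le> j \<and> 2 \<le> k \<and> g k \<le> g j \<and> g j < 2 ^ w"

fun run_macros :: "macro list \<Rightarrow> stream_state \<Rightarrow> stream_state" where
  "run_macros [] S = S"
| "run_macros (m # ms) S = run_macros ms (run_macro m S)"

fun safe_macros :: "nat \<Rightarrow> nat list \<Rightarrow> macro list \<Rightarrow> stream_state \<Rightarrow> bool" where
  "safe_macros w inp [] S \<longleftrightarrow> True"
| "safe_macros w inp (m # ms) S \<longleftrightarrow> safe_macro w inp m S \<and> safe_macros w inp ms (run_macro m S)"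

text \<open>The address \<open>2 ^ w\<close> of the empty output is the word \<open>0\<close>, hence
  the \<open>mod\<close>. \<open>length inp < 2 ^ w\<close> makes the address just past the input a
  word as well.\<close>

fun represents :: "nat \<Rightarrow> nat list \<Rightarrow> nat \<Rightarrow> stream_state \<Rightarrow> ram \<Rightarrow> bool" where
  "represents w inp l (rest, out, g) C \<longleftrightarrow>
     pc C = l \<and> 1 < (2 :: nat) ^ w \<and> length inp < 2 ^ w \<and> length inp + length out \<le> 2 ^ w \<and>
     reg C 0 = (2 ^ w - length out) mod 2 ^ w \<and>
     (\<exists>pre. inp = pre @ rest \<and> reg C 1 = length pre) \<and>
     (\<forall>i\<ge>2. reg C i = g i) \<and> g 7 = 0 \<and> g 8 = 1 \<and>
     (\<forall>a<length inp. mem C a = inp ! a) \<and>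
     (\<forall>i<length out. mem C (2 ^ w + i - length out) = out ! i)"

section \<open>Simulation of streaming programs on the RAM\<close>

lemma step_at:
  assumes "P = pre @ ins # post" "pc C = length pre"
  shows "step w P C = exec w ins C"
  using assms by (simp add: step_def halted_def)

text \<open>The first decrement wraps around from \<open>0\<close> to \<open>W - 1\<close>; all
  later ones are ordinary.\<close>

lemma mod_decrement:
  fixes n W :: nat
  assumes "n < W" "1 < W"
  shows "((W - n) mod W + W - 1) mod W = W - Suc n"
proof (cases "n = 0")
  case False
  then have "(W - n) mod W = W - n" using assms by simp
  then show ?thesis using assms False by (simp add: mod_if)
qed (use assms in simp)

lemma code_correct:
  assumes P: "P = pre @ code m @ post"
    and C: "represents w inp (length pre) S C"
    and safe: "safe_macro w inp m S"
  shows "represents w inp (length pre + length (code m)) (run_macro m S)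
           ((step w P ^^ length (code m)) C)"
proof -
  obtain rest out g where S: "S = (rest, out, g)" by (cases S)
  show ?thesis
  proof (cases m)
    case (Read i)
    obtain a rest' where r: "rest = a # rest'"
      using safe unfolding S Read by (cases rest) auto
    obtain pre' where p: "inp = pre' @ rest" "reg C 1 = length pre'"
      using C unfolding S by auto
    have i: "2 \<le> i" "i \<noteq> 7" "i \<noteq> 8" using safe unfolding S Read by (auto simp: free_reg_def)
    define C1 where "C1 = exec w (Load i 1) C"
    have 1: "step w P C = C1" unfolding C1_def
      using C P by (intro step_at[of _ pre]) (auto simp: S Read)
    have 2: "step w P C1 = exec w (Add 1 1 8) C1"
      using C P by (intro step_at[of _ "pre @ [Load i 1]"]) (auto simp: S Read C1_def)
    have n: "Suc (length pre') < 2 ^ w \<or> rest' = []" "Suc (length pre') \<le> length inp"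
      using C p r by (auto simp: S)
    \<comment> \<open>The reading address does not wrap around, even after the last input
      word.\<close>
    have "length inp < 2 ^ w" using C by (simp add: S)
    then have m: "Suc (length pre') mod 2 ^ w = Suc (length pre')" using n by simp
    have a: "mem C (length pre') = a" using C p r by (simp add: S)
    have r1: "reg C 1 = length pre'" "reg C 8 = 1" using p(2) C by (auto simp: S)
    have "(step w P ^^ length (code m)) C = exec w (Add 1 1 8) C1"
      by (simp add: Read 1 2)
    also have "\<dots> = C\<lparr>pc := length pre + 2, reg := (reg C)(i := a, 1 := Suc (length pre'))\<rparr>"
      using C i r1 m a by (simp add: S C1_def)
    finally have run: "(step w P ^^ length (code m)) C = \<dots>" .
    have "\<exists>pre''. inp = pre'' @ rest' \<and> Suc (length pre') = length pre''"
      using p r by (intro exI[of _ "pre' @ [a]"]) simp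
    then show ?thesis
      unfolding run using C i unfolding S Read by (simp add: r)
  next
    case (Emit i)
    have lt: "length inp + length out < 2 ^ w" "2 \<le> i" using safe by (auto simp: S Emit)
    define C1 where "C1 = exec w (Sub 0 0 8) C"
    have 1: "step w P C = C1" unfolding C1_def
      using C P by (intro step_at[of _ pre]) (auto simp: S Emit)
    have 2: "step w P C1 = exec w (Store 0 i) C1"
      using C P by (intro step_at[of _ "pre @ [Sub 0 0 8]"]) (auto simp: S Emit C1_def)
    have r: "reg C1 0 = 2 ^ w - Suc (length out)"
      using C lt mod_decrement[of "length out" "2 ^ w"] by (simp add: S C1_def)
    \<comment> \<open>The cell written, \<open>2 ^ w - Suc (length out)\<close>, is at or above
      \<open>length inp\<close>.\<close>
    have "mem (exec w (Store 0 i) C1) a = inp ! a" if "a < length inp" for a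
      using C lt that r by (auto simp: S C1_def)
    moreover have "mem (exec w (Store 0 i) C1) (2 ^ w + b - Suc (length out)) = (g i # out) ! b"
      if "b < Suc (length out)" for b
    proof (cases b)
      case 0
      then show ?thesis using r C lt by (simp add: S C1_def)
    next
      case (Suc b')
      \<comment> \<open>Words written earlier keep their addresses, while their index in the output
        grows by one.\<close>
      have "2 ^ w + b - Suc (length out) = 2 ^ w + b' - length out"
        "2 ^ w + b' - length out \<noteq> 2 ^ w - Suc (length out)"
        using Suc lt by simp_all
      then show ?thesis using r C that Suc by (simp add: S C1_def)
    qed
    moreover have "(step w P ^^ length (code m)) C = exec w (Store 0 i) C1"
      by (simp add: Emit 1 2)
    ultimately show ?thesis
      using C lt r by (simp add: S Emit) (auto simp: C1_def)
  next
    case (Plus i j k)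
    have 1: "step w P C = exec w (Add i j k) C"
      using C P by (intro step_at[of _ pre]) (auto simp: S Plus)
    show ?thesis using C safe by (auto simp: S Plus 1 free_reg_def)
  next
    case (Minus i j k)
    have 1: "step w P C = exec w (Sub i j k) C"
      using C P by (intro step_at[of _ pre]) (auto simp: S Minus)
    \<comment> \<open>Since \<open>g k \<le> g j\<close>, the \<open>mod\<close> removes exactly the
      added \<open>2 ^ w\<close>.\<close>
    have "g j + 2 ^ w - g k = (g j - g k) + 2 ^ w" "g j - g k < 2 ^ w"
      using safe by (auto simp: S Minus)
    then have "(g j + 2 ^ w - g k) mod 2 ^ w = g j - g k"
      by (simp only: mod_add_self2 mod_less)
    then have "step w P C = C\<lparr>pc := Suc (pc C), reg := (reg C)(i := g j - g k)\<rparr>"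
      using C safe by (simp add: S Minus 1)
    then show ?thesis using C safe by (simp add: S Minus free_reg_def)
  qed
qed

definition compile :: "macro list \<Rightarrow> instr list" where
  "compile ms = concat (map code ms)"

lemma compile_simps [simp]: "compile [] = []" "compile (m # ms) = code m @ compile ms"
  by (simp_all add: compile_def)

text \<open>Compiled code contains no jumps, so its number of steps is its length.\<close>

lemma compile_correct:
  assumes "P = pre @ compile ms @ post"
    and "represents w inp (length pre) S C"
    and "safe_macros w inp ms S"
  shows "represents w inp (length pre + length (compile ms)) (run_macros ms S)
           ((step w P ^^ length (compile ms)) C)"
  using assms
proof (induction ms arbitrary: pre S C)
  case (Cons m ms)
  have "represents w inp (length pre + length (code m)) (run_macro m S)
      ((step w P ^^ length (code m)) C)"
    using Cons.prems by (intro code_correct[of _ _ _ "compile ms @ post"]) auto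
  then have "represents w inp (length (pre @ code m) + length (compile ms))
      (run_macros ms (run_macro m S))
      ((step w P ^^ length (compile ms)) ((step w P ^^ length (code m)) C))"
    using Cons.prems by (intro Cons.IH) auto
  then show ?case by (simp add: funpow_add add.commute[of "length (code m)"] add.assoc)
qed simp

lemma represents_jump:
  assumes "P ! l = JumpLess i j l'" "l < length P" "2 \<le> i" "2 \<le> j"
    and "represents w inp l (rest, out, g) C"
  shows "represents w inp (if g i < g j then l' else Suc l) (rest, out, g) (step w P C)"
  using assms by (auto simp: step_def halted_def)

lemma represents_goto:
  assumes "P ! l = Jump l'" "l < length P" "represents w inp l S C"
  shows "represents w inp l' S (step w P C)"
  using assms by (cases S) (auto simp: step_def halted_def)


section \<open>The program\<close>

text \<open>Register \<open>2\<close> holds the number of automata still to be read, \<open>3\<close> the number of states so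
  far, \<open>4\<close> the number of transitions so far, \<open>5\<close> the number of transitions still to be
  read of the current automaton, \<open>6\<close> its number of states and \<open>9\<close> the number of variables. The
  code for an automaton starts at \<open>4\<close>, that for a transition at \<open>36\<close>; the two loops are tested
  at \<open>58\<close> and \<open>55\<close>, and the header of the output is written from \<open>59\<close> on.\<close>

definition prologue :: "instr list" where
  "prologue = [Const 8 1, Const 1 1, Const 3 2, Load 2 7]"

text \<open>The words of a transition are emitted last to first: the entry from \<open>0\<close>
  comes first, then the exit to \<open>1\<close>. Register \<open>4\<close> is increased by two for
  these and by the automaton's own number of transitions.\<close>

definition automaton_macros :: "macro list" where
  "automaton_macros =
     [Read 9, Read 6, Read 10, Read 11, Read 5, Plus 10 10 3, Plus 11 11 3,
      Emit 10, Emit 7, Emit 7, Emit 7, Emit 8, Emit 7, Emit 7, Emit 11,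
      Plus 4 4 8, Plus 4 4 8, Plus 4 4 5]"

text \<open>Only source and target are shifted; the two label words pass through unchanged, whatever
  the label is.\<close>

definition transition_macros :: "macro list" where
  "transition_macros =
     [Read 10, Read 11, Read 12, Read 13, Plus 10 10 3, Plus 13 13 3,
      Emit 13, Emit 12, Emit 11, Emit 10, Minus 5 5 8]"

text \<open>The offset advances only now, as the transitions just read needed its old value.\<close>

definition next_macros :: "macro list" where
  "next_macros = [Plus 3 3 6, Minus 2 2 8]"

text \<open>Registers \<open>8\<close> and \<open>7\<close> hold \<open>1\<close> and
  \<open>0\<close>, which are also the numbers of the new final and initial state.\<close>

definition header_macros :: "macro list" where
  "header_macros = [Emit 4, Emit 8, Emit 7, Emit 3, Emit 9]"

definition union_program :: "instr list" where
  "union_program =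
     prologue @ compile automaton_macros @ [Jump 55] @ compile transition_macros @
     [JumpLess 7 5 36] @ compile next_macros @ [JumpLess 7 2 4] @ compile header_macros"

lemmas macros_defs = automaton_macros_def transition_macros_def next_macros_def header_macros_def

lemma length_code:
  "length prologue = 4" "length (compile automaton_macros) = 31"
  "length (compile transition_macros) = 19" "length (compile next_macros) = 2"
  "length (compile header_macros) = 10" "length union_program = 69"
  by (simp_all add: union_program_def prologue_def macros_defs)

lemma union_program_jumps:
  "union_program ! 35 = Jump 55" "union_program ! 55 = JumpLess 7 5 36"
  "union_program ! 58 = JumpLess 7 2 4"
  by (simp_all add: union_program_def prologue_def macros_defs)

lemma union_program_blocks:
  assumes "safe_macros w inp ms S" "represents w inp l S C"
    and "(l, ms) \<in> {(4, automaton_macros), (36, transition_macros), (56, next_macros),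
      (59, header_macros)}"
  shows "represents w inp (l + length (compile ms)) (run_macros ms S)
           ((step w union_program ^^ length (compile ms)) C)"
proof -
  let ?p1 = "prologue @ compile automaton_macros @ [Jump 55]"
  let ?p2 = "?p1 @ compile transition_macros @ [JumpLess 7 5 36]"
  let ?p3 = "?p2 @ compile next_macros @ [JumpLess 7 2 4]"
  have "(l, ms) = (length prologue, automaton_macros) \<or> (l, ms) = (length ?p1, transition_macros) \<or>
      (l, ms) = (length ?p2, next_macros) \<or> (l, ms) = (length ?p3, header_macros)"
    using assms(3) by (simp add: length_code)
  moreover have "\<exists>post. union_program = prologue @ compile automaton_macros @ post"
    "\<exists>post. union_program = ?p1 @ compile transition_macros @ post"
    "\<exists>post. union_program = ?p2 @ compile next_macros @ post"
    "\<exists>post. union_program = ?p3 @ compile header_macros @ post"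
    by (simp_all add: union_program_def)
  ultimately obtain pre post where "union_program = pre @ compile ms @ post" "length pre = l"
    by (elim disjE) (metis prod.inject)+
  then show ?thesis using compile_correct[of _ pre] assms(1,2) by blast
qed


section \<open>The two loops and their step counts\<close>

lemma represents_constants:
  assumes "represents w inp l (rest, out, g) C"
  shows "g 7 = 0" "g 8 = 1"
  using assms by simp_all

declare represents.simps [simp del]

lemma run_transition:
  assumes C: "represents w inp 36
      (transition_words \<alpha> \<nu> \<eta> (p, l, q) @ rest, out, g) C"
    and "0 < g 5" "g 5 < 2 ^ w" "\<eta> p + g 3 < 2 ^ w" "\<eta> q + g 3 < 2 ^ w"
    and "length inp + length out + 4 \<le> 2 ^ w"
  obtains g' where "represents w inp 55
      (rest, transition_words \<alpha> \<nu> (\<lambda>q. \<eta> q + g 3) (p, l, q) @ out, g')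
      ((step w union_program ^^ 19) C)"
    "g' 5 = g 5 - 1" "\<forall>i\<in>{2, 3, 4, 6, 9}. g' i = g i"
proof -
  \<comment> \<open>Every label takes two words, so the block is run without distinguishing
    labels.\<close>
  obtain a b where l: "label_words \<alpha> \<nu> l = [a, b]"
    by (cases "(\<alpha>, \<nu>, l)" rule: label_words.cases) auto
  have g: "g 7 = 0" "g 8 = 1" using C represents_constants by blast+
  let ?S = "(transition_words \<alpha> \<nu> \<eta> (p, l, q) @ rest, out, g)"
  have "safe_macros w inp transition_macros ?S"
    using assms(2-) g by (simp add: transition_macros_def l free_reg_def)
  from union_program_blocks[OF this C]
  have "represents w inp 55 (run_macros transition_macros ?S) ((step w union_program ^^ 19) C)"
    by (simp add: length_code)
  then show ?thesis
    using g by (intro that[of "snd (snd (run_macros transition_macros ?S))"])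
      (simp_all add: transition_macros_def l)
qed

lemma funpow_funpow: "(f ^^ m) ((f ^^ n) x) = (f ^^ (n + m)) x"
  by (simp add: funpow_add add.commute[of n])

text \<open>A round takes one test and \<open>19\<close> further steps; one more test leaves the
  loop. Writing backwards reverses the list.\<close>

lemma run_transitions:
  assumes "represents w inp 55 (concat (map (transition_words \<alpha> \<nu> \<eta>) ts) @ rest, out, g) C"
    and "g 5 = length ts" "g 3 = k" "length ts < 2 ^ w"
    and "\<forall>(p, l, q)\<in>set ts. \<eta> p + k < 2 ^ w \<and> \<eta> q + k < 2 ^ w"
    and "length inp + length out + 4 * length ts \<le> 2 ^ w"
  shows "\<exists>g'. represents w inp 56
      (rest, concat (map (transition_words \<alpha> \<nu> (\<lambda>q. \<eta> q + k)) (rev ts)) @ out, g')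
      ((step w union_program ^^ (20 * length ts + 1)) C) \<and> (\<forall>i\<in>{2, 3, 4, 6, 9}. g' i = g i)"
  using assms
proof (induction ts arbitrary: out g C)
  case Nil
  have "g 7 = 0" using Nil represents_constants by blast
  with represents_jump[OF union_program_jumps(2) _ _ _ Nil(1)] Nil show ?case
    by (intro exI[of _ g]) (simp add: length_code)
next
  case (Cons t ts)
  obtain p l q where t: "t = (p, l, q)" by (cases t)
  have "g 7 = 0" using Cons.prems(1) represents_constants by blast
  then have "represents w inp 36 (transition_words \<alpha> \<nu> \<eta> (p, l, q) @
      concat (map (transition_words \<alpha> \<nu> \<eta>) ts) @ rest, out, g) (step w union_program C)"
    using represents_jump[OF union_program_jumps(2) _ _ _ Cons.prems(1)] Cons.prems(2)
    by (simp add: length_code t)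
  then obtain g1 where g1: "represents w inp 55 (concat (map (transition_words \<alpha> \<nu> \<eta>) ts) @ rest,
      transition_words \<alpha> \<nu> (\<lambda>q. \<eta> q + g 3) (p, l, q) @ out, g1)
      ((step w union_program ^^ 19) (step w union_program C))"
    "g1 5 = g 5 - 1" "\<forall>i\<in>{2, 3, 4, 6, 9}. g1 i = g i"
    by (rule run_transition) (use Cons.prems t in auto)
  have "length (transition_words \<alpha> \<nu> (\<lambda>q. \<eta> q + g 3) (p, l, q)) = 4"
    by (cases "(\<alpha>, \<nu>, l)" rule: label_words.cases) auto
  then obtain g' where g': "represents w inp 56
      (rest, concat (map (transition_words \<alpha> \<nu> (\<lambda>q. \<eta> q + k)) (rev ts)) @
        transition_words \<alpha> \<nu> (\<lambda>q. \<eta> q + g 3) (p, l, q) @ out, g')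
      ((step w union_program ^^ (20 * length ts + 1))
        ((step w union_program ^^ 19) (step w union_program C)))"
    "\<forall>i\<in>{2, 3, 4, 6, 9}. g' i = g1 i"
    using Cons.IH[OF g1(1)] g1(2,3) Cons.prems by auto
  have "(step w union_program ^^ (20 * length ts + 1))
        ((step w union_program ^^ 19) ((step w union_program ^^ 1) C)) =
      (step w union_program ^^ (20 * length (t # ts) + 1)) C"
    unfolding funpow_funpow by (rule arg_cong[where f = "\<lambda>n. (step w union_program ^^ n) C"]) simp
  then show ?case
    using g' g1(3) Cons.prems(3) by (intro exI[of _ g']) (simp add: t)
qed

fun component_words ::
  "('a \<Rightarrow> nat) \<Rightarrow> ('v \<Rightarrow> nat) \<Rightarrow> ('a, 'v, 'q) component \<Rightarrow> nat list" where
  "component_words \<alpha> \<nu> (A, \<eta>, ts) =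
     [card (vars A), card (states A), \<eta> (start A), \<eta> (final A), length ts] @
     concat (map (transition_words \<alpha> \<nu> \<eta>) ts)"

lemma transition_words_map_transition:
  "transition_words \<alpha> \<nu> (\<lambda>q. q) (map_transition e t) = transition_words \<alpha> \<nu> e t"
  by (cases t) simp

abbreviation transitions_words ::
  "('a \<Rightarrow> nat) \<Rightarrow> ('v \<Rightarrow> nat) \<Rightarrow> ('a, 'v, nat) transition list \<Rightarrow> nat list" where
  "transitions_words \<alpha> \<nu> ts \<equiv> concat (map (transition_words \<alpha> \<nu> (\<lambda>q. q)) ts)"

lemma length_transitions_words: "length (transitions_words \<alpha> \<nu> ts) = 4 * length ts"
proof -
  have "length (transition_words \<alpha> \<nu> (\<lambda>q. q) t) = 4" for t :: "('a, 'b, nat) transition"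
    by (cases "(\<alpha>, \<nu>, fst (snd t))" rule: label_words.cases; cases t) auto
  then show ?thesis by (induction ts) auto
qed

lemma length_component_words:
  "length (component_words \<alpha> \<nu> X) = 5 + 4 * num_transitions X"
proof -
  obtain A \<eta> ts where X: "X = (A, \<eta>, ts)" by (cases X)
  have "length (transition_words \<alpha> \<nu> \<eta> t) = 4" for t
    by (cases "(\<alpha>, \<nu>, fst (snd t))" rule: label_words.cases; cases t) auto
  then have "length (concat (map (transition_words \<alpha> \<nu> \<eta>) ts)) = 4 * length ts"
    by (induction ts) auto
  then show ?thesis by (simp add: X)
qed

lemma length_component_transitions:
  "length (component_transitions k X) = 2 + num_transitions X"
  by (cases X) simp

lemma length_union_transitions:
  "length (union_transitions k Xs) = (\<Sum>X\<leftarrow>Xs. 2 + num_transitions X)"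
  by (induction Xs arbitrary: k) (simp_all add: length_component_transitions)

text \<open>The constant \<open>35\<close> consists of \<open>31\<close> steps for the automaton's
  header and its new transitions, the jump to the inner test, the last such test and the two steps
  of \<open>next_macros\<close>.\<close>

lemma run_component:
  assumes C: "represents w inp 4 (component_words \<alpha> \<nu> X @ rest, out, g) C"
    and X: "component X"
    and g: "0 < g 2" "g 2 < 2 ^ w" "g 3 + num_states X < 2 ^ w"
      "g 4 + (2 + num_transitions X) < 2 ^ w"
    and out: "length inp + length out + 4 * (2 + num_transitions X) \<le> 2 ^ w"
  shows "\<exists>g'. represents w inp 58
      (rest, transitions_words \<alpha> \<nu> (component_transitions (g 3) X) @ out, g')
      ((step w union_program ^^ (35 + 20 * num_transitions X)) C) \<and>
      g' 2 = g 2 - 1 \<and> g' 3 = g 3 + num_states X \<and> g' 4 = g 4 + (2 + num_transitions X) \<and>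
      g' 9 = card (vars (fst X))"
proof -
  let ?s = "step w union_program"
  obtain A \<eta> ts where A: "X = (A, \<eta>, ts)" by (cases X)
  have z: "g 7 = 0" "g 8 = 1" using C represents_constants by blast+
  have "start A \<in> states A" "final A \<in> states A"
    using X by (auto simp: A is_vset_automaton_def)
  then have st: "\<eta> (start A) + g 3 < 2 ^ w" "\<eta> (final A) + g 3 < 2 ^ w"
    using X component_bound[of A \<eta> ts] g(3) by (fastforce simp: A)+
  let ?S = "(component_words \<alpha> \<nu> X @ rest, out, g)"
  let ?out = "transitions_words \<alpha> \<nu> [(\<eta> (final A) + g 3, None, 1), (0, None, \<eta> (start A) + g 3)] @ out"
  define g1 where "g1 = snd (snd (run_macros automaton_macros ?S))"
  have safe: "safe_macros w inp automaton_macros ?S"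
    using g out z st by (simp add: automaton_macros_def A free_reg_def)
  have r1: "run_macros automaton_macros ?S =
      (concat (map (transition_words \<alpha> \<nu> \<eta>) ts) @ rest, ?out, g1)"
    using z by (simp add: automaton_macros_def A g1_def)
  have g1: "g1 2 = g 2" "g1 3 = g 3" "g1 4 = g 4 + (2 + num_transitions X)" "g1 5 = length ts"
    "g1 6 = num_states X" "g1 9 = card (vars A)"
    using z by (simp_all add: automaton_macros_def A g1_def)
  have "represents w inp 35 (concat (map (transition_words \<alpha> \<nu> \<eta>) ts) @ rest, ?out, g1)
      ((?s ^^ 31) C)"
    using union_program_blocks[OF safe C] unfolding r1 by (simp add: length_code)
  then have "represents w inp 55 (concat (map (transition_words \<alpha> \<nu> \<eta>) ts) @ rest, ?out, g1)
      (?s ((?s ^^ 31) C))"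
    by (rule represents_goto[OF union_program_jumps(1), rotated]) (simp add: length_code)
  then have "\<exists>g'. represents w inp 56
      (rest, concat (map (transition_words \<alpha> \<nu> (\<lambda>q. \<eta> q + g 3)) (rev ts)) @ ?out, g')
      ((?s ^^ (20 * length ts + 1)) (?s ((?s ^^ 31) C))) \<and> (\<forall>i\<in>{2, 3, 4, 6, 9}. g' i = g1 i)"
  proof (rule run_transitions)
    show "\<forall>(p, l, q)\<in>set ts. \<eta> p + g 3 < 2 ^ w \<and> \<eta> q + g 3 < 2 ^ w"
    proof (clarify)
      fix p l q assume t: "(p, l, q) \<in> set ts"
      have c: "component (A, \<eta>, ts)" using X by (simp add: A)
      show "\<eta> p + g 3 < 2 ^ w \<and> \<eta> q + g 3 < 2 ^ w"
        using component_bound[OF c component_transitionD(1)[OF c t]]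
          component_bound[OF c component_transitionD(2)[OF c t]] g(3)
        by (simp add: A)
    qed
    show "length inp + length ?out + 4 * length ts \<le> 2 ^ w"
      using out by (simp add: A length_transitions_words)
    show "length ts < 2 ^ w" using g(4) by (simp add: A)
  qed (fact g1)+
  then obtain g2 where g2: "represents w inp 56
      (rest, transitions_words \<alpha> \<nu> (component_transitions (g 3) X) @ out, g2)
      ((?s ^^ (20 * length ts + 1)) ((?s ^^ 1) ((?s ^^ 31) C)))"
    and g2': "\<forall>i\<in>{2, 3, 4, 6, 9}. g2 i = g1 i"
    by (auto simp: A transition_words_map_transition comp_def)
  have z2: "g2 7 = 0" "g2 8 = 1" using g2 represents_constants by blast+
  define S2 where "S2 = (rest, transitions_words \<alpha> \<nu> (component_transitions (g 3) X) @ out, g2)"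
  have "safe_macros w inp next_macros S2"
    using g2' g1 g z2 by (simp add: S2_def next_macros_def free_reg_def)
  from union_program_blocks[OF this g2[folded S2_def]]
  have "represents w inp 58 (run_macros next_macros S2)
      ((?s ^^ 2) ((?s ^^ (20 * length ts + 1)) ((?s ^^ 1) ((?s ^^ 31) C))))"
    by (simp add: length_code)
  also have "(?s ^^ 2) ((?s ^^ (20 * length ts + 1)) ((?s ^^ 1) ((?s ^^ 31) C))) =
      (?s ^^ (35 + 20 * num_transitions X)) C"
    unfolding funpow_funpow
    by (rule arg_cong[where f = "\<lambda>n. (?s ^^ n) C"]) (simp add: A)
  finally show ?thesis
    using g2' g1 z2 by (intro exI[of _ "snd (snd (run_macros next_macros S2))"])
      (simp add: S2_def next_macros_def A)
qed

text \<open>The test after each automaton turns \<open>35\<close> into \<open>36\<close>. It comes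
  at the end of the loop body, hence \<open>Xs \<noteq> []\<close>.\<close>

lemma run_components:
  assumes "represents w inp 4 (concat (map (component_words \<alpha> \<nu>) Xs) @ rest, out, g) C"
    and "Xs \<noteq> []" "\<forall>X\<in>set Xs. component X \<and> card (vars (fst X)) = v"
    and "g 2 = length Xs" "length Xs < 2 ^ w" "g 3 + (\<Sum>X\<leftarrow>Xs. num_states X) < 2 ^ w"
    and "g 4 + (\<Sum>X\<leftarrow>Xs. 2 + num_transitions X) < 2 ^ w"
    and "length inp + length out + 4 * (\<Sum>X\<leftarrow>Xs. 2 + num_transitions X) \<le> 2 ^ w"
  shows "\<exists>g'. represents w inp 59
      (rest, transitions_words \<alpha> \<nu> (union_transitions (g 3) Xs) @ out, g')
      ((step w union_program ^^ (\<Sum>X\<leftarrow>Xs. 36 + 20 * num_transitions X)) C) \<and>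
      g' 3 = g 3 + (\<Sum>X\<leftarrow>Xs. num_states X) \<and>
      g' 4 = g 4 + (\<Sum>X\<leftarrow>Xs. 2 + num_transitions X) \<and> g' 9 = v"
  using assms
proof (induction Xs arbitrary: out g C)
  case (Cons X Xs)
  let ?s = "step w union_program"
  let ?out = "transitions_words \<alpha> \<nu> (component_transitions (g 3) X) @ out"
  obtain g1 where C1: "represents w inp 58 (concat (map (component_words \<alpha> \<nu>) Xs) @ rest, ?out, g1)
      ((?s ^^ (35 + 20 * num_transitions X)) C)"
    and g1: "g1 2 = length Xs" "g1 3 = g 3 + num_states X" "g1 4 = g 4 + (2 + num_transitions X)"
      "g1 9 = v"
    using run_component[of w inp \<alpha> \<nu> X "concat (map (component_words \<alpha> \<nu>) Xs) @ rest" out g C]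
      Cons.prems by auto
  have z: "g1 7 = 0" using C1 represents_constants by blast
  have C2: "represents w inp (if Xs = [] then 59 else 4)
      (concat (map (component_words \<alpha> \<nu>) Xs) @ rest, ?out, g1)
      ((?s ^^ 1) ((?s ^^ (35 + 20 * num_transitions X)) C))"
    using represents_jump[OF union_program_jumps(3) _ _ _ C1] z g1(1)
    by (cases Xs) (simp_all add: length_code)
  have t: "(?s ^^ n) ((?s ^^ 1) ((?s ^^ (35 + 20 * num_transitions X)) C)) =
      (?s ^^ (36 + 20 * num_transitions X + n)) C" for n
    unfolding funpow_funpow by (rule arg_cong[where f = "\<lambda>n. (?s ^^ n) C"]) simp
  show ?case
  proof (cases "Xs = []")
    case True
    then show ?thesis
      using C2 g1 t[of 0] by (intro exI[of _ g1]) (simp)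
  next
    case False
    then have "represents w inp 4 (concat (map (component_words \<alpha> \<nu>) Xs) @ rest, ?out, g1)
      ((?s ^^ 1) ((?s ^^ (35 + 20 * num_transitions X)) C))"
      using C2 by simp
    from Cons.IH[OF this False] obtain g' where "represents w inp 59
        (rest, transitions_words \<alpha> \<nu> (union_transitions (g1 3) Xs) @ ?out, g')
        ((?s ^^ (\<Sum>X\<leftarrow>Xs. 36 + 20 * num_transitions X))
          ((?s ^^ 1) ((?s ^^ (35 + 20 * num_transitions X)) C)))"
      "g' 3 = g1 3 + (\<Sum>X\<leftarrow>Xs. num_states X)"
      "g' 4 = g1 4 + (\<Sum>X\<leftarrow>Xs. 2 + num_transitions X)" "g' 9 = v"
      using Cons.prems g1 by (auto simp: length_transitions_words length_component_transitions)
    then show ?thesis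
      unfolding t using g1 by (intro exI[of _ g']) (simp)
  qed
qed simp

section \<open>Total running time and word size\<close>

lemma sum_list_affine:
  fixes f :: "'b \<Rightarrow> nat"
  shows "(\<Sum>x\<leftarrow>xs. a + b * f x) = a * length xs + b * (\<Sum>x\<leftarrow>xs. f x)"
  by (induction xs) (simp_all add: algebra_simps)

text \<open>With \<open>t\<close> transitions, an automaton takes \<open>5 + 4 * t\<close> input
  words and causes \<open>4 * (2 + t)\<close> output words, in total \<open>13 + 8 * t\<close>. The
  \<open>6\<close> covers the leading input word and the five header words. The \<open>14\<close>
  steps are those of prologue and header.\<close>

lemma union_program_correct:
  assumes inp: "inp = length Xs # concat (map (component_words \<alpha> \<nu>) Xs)"
    and Xs: "Xs \<noteq> []" "\<forall>X\<in>set Xs. component X \<and> card (vars (fst X)) = v"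
    and w: "6 + (\<Sum>X\<leftarrow>Xs. num_states X) + (\<Sum>X\<leftarrow>Xs. 13 + 8 * num_transitions X) < 2 ^ w"
  shows "outputs_within w union_program inp (14 + (\<Sum>X\<leftarrow>Xs. 36 + 20 * num_transitions X))
     ([v, 2 + (\<Sum>X\<leftarrow>Xs. num_states X), 0, 1, length (union_transitions 2 Xs)] @
      transitions_words \<alpha> \<nu> (union_transitions 2 Xs))"
proof -
  let ?s = "step w union_program"
  let ?N = "\<Sum>X\<leftarrow>Xs. num_states X" and ?T = "\<Sum>X\<leftarrow>Xs. num_transitions X"
  have "(\<Sum>X\<leftarrow>Xs. 2 + num_transitions X) = 2 * length Xs + ?T"
    using sum_list_affine[of 2 1 num_transitions Xs] by (simp only: mult_1)
  moreover have "6 + ?N + 13 * length Xs + 8 * ?T < 2 ^ w"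
    using w unfolding sum_list_affine by simp
  ultimately have sums: "6 + ?N + 13 * length Xs + 8 * ?T < 2 ^ w"
    "(\<Sum>X\<leftarrow>Xs. 2 + num_transitions X) = 2 * length Xs + ?T"
    by (simp_all only:)
  have len: "length inp = 1 + 5 * length Xs + 4 * ?T"
    unfolding inp by (induction Xs) (simp_all add: length_component_words)
  define C where "C = (?s ^^ 4) (initial_ram inp)"
  \<comment> \<open>Register \<open>3\<close> starts at \<open>2\<close>, both the first offset and
    the number of new states.\<close>
  define g where "g = (\<lambda>i :: nat. 0 :: nat)(8 := 1, 3 := 2, 2 := length Xs)"
  have funpow_4: "(f ^^ 4) x = f (f (f (f x)))" for f :: "ram \<Rightarrow> ram" and x
    by (simp add: eval_nat_numeral)
  have "union_program ! 0 = Const 8 1" "union_program ! Suc 0 = Const 1 1"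
    "union_program ! Suc (Suc 0) = Const 3 2" "union_program ! Suc (Suc (Suc 0)) = Load 2 7"
    by (simp_all add: union_program_def prologue_def)
  moreover have "1 mod 2 ^ w = (1 :: nat)" "2 mod 2 ^ w = (2 :: nat)"
    using sums(1) by (simp_all only: mod_less)
  ultimately have "C = \<lparr>pc = Suc (Suc (Suc (Suc 0))), reg = (\<lambda>_. 0)(8 := 1, 1 := 1, 3 := 2, 2 := length Xs),
      mem = mem (initial_ram inp)\<rparr>"
    by (simp add: C_def funpow_4 step_def halted_def length_code initial_ram_def inp)
  then have C: "represents w inp 4 (concat (map (component_words \<alpha> \<nu>) Xs) @ [], [], g) C"
    using sums(1) len by (auto simp: represents.simps g_def initial_ram_def inp intro!: exI[of _ "[length Xs]"])
  have "\<exists>g'. represents w inp 59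
      ([], transitions_words \<alpha> \<nu> (union_transitions (g 3) Xs) @ [], g')
      ((?s ^^ (\<Sum>X\<leftarrow>Xs. 36 + 20 * num_transitions X)) C) \<and>
      g' 3 = g 3 + ?N \<and> g' 4 = g 4 + (\<Sum>X\<leftarrow>Xs. 2 + num_transitions X) \<and> g' 9 = v"
    by (rule run_components[OF C Xs]) (use sums len in \<open>auto simp: g_def\<close>)
  then obtain g1 where C1: "represents w inp 59 ([], transitions_words \<alpha> \<nu> (union_transitions 2 Xs), g1)
      ((?s ^^ (\<Sum>X\<leftarrow>Xs. 36 + 20 * num_transitions X)) C)"
    and g1: "g1 3 = 2 + ?N" "g1 4 = length (union_transitions 2 Xs)" "g1 9 = v"
    by (auto simp: g_def length_union_transitions)
  have z: "g1 7 = 0" "g1 8 = 1" using C1 represents_constants by blast+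
  let ?S = "([], transitions_words \<alpha> \<nu> (union_transitions 2 Xs), g1)"
  let ?out = "[v, 2 + ?N, 0, 1, length (union_transitions 2 Xs)] @
      transitions_words \<alpha> \<nu> (union_transitions 2 Xs)"
  have lo: "length inp + length ?out \<le> 2 ^ w"
    using sums len by (simp add: length_transitions_words length_union_transitions)
  have header: "run_macros header_macros ?S = ([], ?out, g1)"
    using z g1 by (simp add: header_macros_def)
  have "safe_macros w inp header_macros ?S"
    using lo by (simp add: header_macros_def)
  from union_program_blocks[OF this C1]
  have "represents w inp 69 ([], ?out, g1)
      ((?s ^^ 10) ((?s ^^ (\<Sum>X\<leftarrow>Xs. 36 + 20 * num_transitions X)) C))"
    unfolding header by (simp add: length_code)
  also have "(?s ^^ 10) ((?s ^^ (\<Sum>X\<leftarrow>Xs. 36 + 20 * num_transitions X)) C) =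
      (?s ^^ (14 + (\<Sum>X\<leftarrow>Xs. 36 + 20 * num_transitions X))) (initial_ram inp)"
    unfolding C_def funpow_funpow
    by (rule arg_cong[where f = "\<lambda>n. (?s ^^ n) (initial_ram inp)"]) simp
  finally have R: "represents w inp 69 ([], ?out, g1)
      ((?s ^^ (14 + (\<Sum>X\<leftarrow>Xs. 36 + 20 * num_transitions X))) (initial_ram inp))" .
  define D where "D = (?s ^^ (14 + (\<Sum>X\<leftarrow>Xs. 36 + 20 * num_transitions X))) (initial_ram inp)"
  define out where "out = ?out"
  have D: "represents w inp 69 ([], out, g1) D" using R unfolding D_def out_def .
  \<comment> \<open>For a nonempty output the \<open>mod\<close> in \<open>represents\<close> has no
    effect.\<close>
  have "0 < length out" "length out \<le> 2 ^ w" using lo by (auto simp: out_def)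
  then have "reg D 0 = 2 ^ w - length out" using D by (simp add: represents.simps)
  then have "halted union_program D \<and> reg D 0 + length out \<le> 2 ^ w \<and>
      (\<forall>i<length out. mem D (reg D 0 + i) = out ! i)"
    using D \<open>length out \<le> 2 ^ w\<close> by (auto simp: represents.simps halted_def length_code)
  then show ?thesis
    unfolding outputs_within_def out_def[symmetric] using D_def by blast
qed

lemma encodes_component:
  assumes "encodes \<alpha> \<nu> A ws" "is_vset_automaton A"
  obtains \<eta> ts where "component (A, \<eta>, ts)" "ws = component_words \<alpha> \<nu> (A, \<eta>, ts)"
  using assms unfolding encodes_def by auto

lemma encodes_components:
  assumes "list_all2 (encodes \<alpha> \<nu>) As wss" "\<forall>A\<in>set As. is_vset_automaton A"
  shows "\<exists>Xs. As = map fst Xs \<and> wss = map (component_words \<alpha> \<nu>) Xs \<and> (\<forall>X\<in>set Xs. component X)"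
  using assms
proof (induction rule: list_all2_induct)
  case (Cons A As ws wss)
  then obtain Xs where "As = map fst Xs" "wss = map (component_words \<alpha> \<nu>) Xs"
    "\<forall>X\<in>set Xs. component X"
    by auto
  moreover obtain \<eta> ts where "component (A, \<eta>, ts)" "ws = component_words \<alpha> \<nu> (A, \<eta>, ts)"
    using Cons encodes_component by (metis list.set_intros(1))
  ultimately show ?case by (intro exI[of _ "(A, \<eta>, ts) # Xs"]) simp
qed simp

text \<open>The start state makes \<open>num_states X\<close> positive, so costs per automaton can
  be charged to states.\<close>

lemma aut_size_component:
  assumes "component X"
  shows "aut_size (fst X) = num_states X + num_transitions X" "0 < num_states X"
  using assms
  by (cases X; auto simp: aut_size_def is_vset_automaton_def card_gt_0_iff
      dest: distinct_card)+

lemma outputs_within_mono: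
  "outputs_within w P inp T out \<Longrightarrow> T \<le> T' \<Longrightarrow> outputs_within w P inp T' out"
  unfolding outputs_within_def by (meson le_trans)

theorem lemma3p9:
  fixes \<alpha> :: "'a::finite \<Rightarrow> nat"
  assumes "CARD('a) \<ge> 2"
    and "infinite (UNIV :: 'v set)"
    and "bij_betw \<alpha> UNIV {..<CARD('a)}"
  shows "\<exists>(P :: instr list) (c :: nat) (d :: nat).
    \<forall>(As :: ('a, 'v, 'q) vset_automaton list) (V :: 'v set) (\<nu> :: 'v \<Rightarrow> nat)
      (w :: nat) (inp :: nat list).
      As \<noteq> [] \<and>
      (\<forall>A\<in>set As. is_vset_automaton A \<and> functional A \<and> vars A = V) \<and>
      bij_betw \<nu> V {..<card V} \<and>
      encodes_list \<alpha> \<nu> As inp \<and>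
      d * (\<Sum>A\<leftarrow>As. aut_size A) < 2 ^ w \<and> (\<forall>u\<in>set inp. u < 2 ^ w) \<longrightarrow>
      (\<exists>(A :: ('a, 'v, nat) vset_automaton) (out :: nat list).
        is_vset_automaton A \<and> functional A \<and>
        spanner_of A = union_spanner V As \<and>
        encodes \<alpha> \<nu> A out \<and>
        outputs_within w P inp (c * (\<Sum>A\<leftarrow>As. aut_size A)) out)"
proof (rule exI[of _ union_program], rule exI[of _ 50], rule exI[of _ 20], intro allI impI,
    elim conjE)
  fix As :: "('a, 'v, 'q) vset_automaton list" and V :: "'v set" and \<nu> w inp
  assume As: "As \<noteq> []" "\<forall>A\<in>set As. is_vset_automaton A \<and> functional A \<and> vars A = V"
    and inp: "encodes_list \<alpha> \<nu> As inp"
    and w: "20 * (\<Sum>A\<leftarrow>As. aut_size A) < 2 ^ w"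
  obtain Xs where Xs: "As = map fst Xs" "\<forall>X\<in>set Xs. component X"
    and inp': "inp = length Xs # concat (map (component_words \<alpha> \<nu>) Xs)"
    using inp encodes_components[of \<alpha> \<nu> As] As(2) unfolding encodes_list_def by fastforce
  interpret components V Xs
    by unfold_locales (use As Xs in auto)
  let ?S = "\<Sum>A\<leftarrow>As. aut_size A"
  let ?N = "sum_list (map num_states Xs)" and ?T = "sum_list (map num_transitions Xs)"
  have "?S = (\<Sum>X\<leftarrow>Xs. num_states X + num_transitions X)"
    unfolding Xs(1) map_map comp_def
    by (intro arg_cong[where f = sum_list] map_cong refl) (use Xs(2) aut_size_component(1) in blast)
  then have S: "?S = ?N + ?T" by (simp only: sum_list_addf)
  have len: "length Xs \<le> ?N" "0 < length Xs"
    using Xs(2) As(1) Xs(1) sum_list_mono[of Xs "\<lambda>_. 1" num_states] aut_size_component(2)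
    by (force simp: sum_list_triv Suc_le_eq)+
  \<comment> \<open>As \<open>1 \<le> k \<le> n\<close>, \<open>6 + 13 * k\<close> is at most
    \<open>19 * n\<close> and \<open>14 + 36 * k\<close> at most \<open>50 * n\<close>; this yields
    the constants \<open>20\<close> and \<open>50\<close>.\<close>
  have "6 + n + (13 * k + 8 * t) \<le> 20 * (n + t)" "14 + (36 * k + 20 * t) \<le> 50 * (n + t)"
    if "k \<le> n" "0 < k" for k n t :: nat
    using that by simp_all
  note this[OF len, of ?T, folded S]
  then have "6 + (\<Sum>X\<leftarrow>Xs. num_states X) + (\<Sum>X\<leftarrow>Xs. 13 + 8 * num_transitions X) \<le> 20 * ?S"
    "14 + (\<Sum>X\<leftarrow>Xs. 36 + 20 * num_transitions X) \<le> 50 * ?S"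
    by (simp_all only: sum_list_affine)
  note bounds = this
  let ?out = "[card V, 2 + (\<Sum>X\<leftarrow>Xs. num_states X), 0, 1, length (union_transitions 2 Xs)] @
      transitions_words \<alpha> \<nu> (union_transitions 2 Xs)"
  have "\<forall>X\<in>set Xs. component X \<and> card (vars (fst X)) = card V"
    using Xs(2) vars_component by simp
  then have "outputs_within w union_program inp
      (14 + (\<Sum>X\<leftarrow>Xs. 36 + 20 * num_transitions X)) ?out"
    by (rule union_program_correct[OF inp' nonempty _ le_less_trans[OF bounds(1) w]])
  then have "outputs_within w union_program inp (50 * ?S) ?out"
    using bounds(2) by (rule outputs_within_mono)
  moreover have "functional U"
    by (rule functional_U) (use As(2) Xs(1) in simp)
  ultimately show "\<exists>(A :: ('a, 'v, nat) vset_automaton) (out :: nat list).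
        is_vset_automaton A \<and> functional A \<and> spanner_of A = union_spanner V As \<and>
        encodes \<alpha> \<nu> A out \<and> outputs_within w union_program inp (50 * ?S) out"
    using is_vset_automaton_U spanner_of_U encodes_U[of \<alpha> \<nu>] unfolding Xs(1) by blast
qed

end
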